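(* For every graph $\mathcal{G}=(V,E)$ with diameter $2$ we have $$M(\mathcal{G})\ge\binom{\#V+1}{2}-\#E.$$
   Context: Graphs are finite, simple and undirected. The diameter of a connected graph is the maximum distance between pairs of vertices, where the distance is the length (number of edges) of a shortest path. For a graph $\mathcal{G}$ with $n$ vertices and adjacency matrix $A$, viewed over $\mathbb{F}_2$, let $C(\mathcal{G})\subseteq\mathbb{F}_2^{2n}$ be the binary linear code generated by the rows of $[I_n|A]$, where $I_n$ is the $n\times n$ identity matrix. The support of a vector is the set of positions of its nonzero entries. A nonzero codeword $c$ of a binary linear code $C$ is minimal if there is no nonzero codeword $c'\in C$ with $\operatorname{supp}(c')\subsetneq\operatorname{supp}(c)$. $M(\mathcal{G})$ denotes the number of minimal codewords of $C(\mathcal{G})$; it does not depend on the labeling of the vertices. *)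

theory Defs
  imports
    "Graph_Theory.Graph_Theory"
    "Jordan_Normal_Form.VS_Connect"
    "HOL-Library.Z2"
begin

text \<open>
  A finite simple undirected graph is a \<^locale>\<open>pair_graph\<close> of the library: finite, loopless,
  with a symmetric arc relation. An undirected edge is thus represented by two opposite arcs,
  so edges are counted via the two-element sets of endpoints rather than via
  \<^const>\<open>parcs\<close>.
\<close>

definition undirected_edges :: "'a pair_pre_digraph \<Rightarrow> 'a set set" where
  "undirected_edges G = {{u, v} | u v. (u, v) \<in> parcs G}"

text \<open>
  The least element below only exists for vertices joined by a path, and the maximum only for a
  nonempty finite vertex set; both notions are meant for finite connected graphs.
\<close>

definition graph_dist :: "'a pair_pre_digraph \<Rightarrow> 'a \<Rightarrow> 'a \<Rightarrow> nat" where
  "graph_dist G u v = (LEAST k. \<exists>p. pre_digraph.apath (with_proj G) u p v \<and> length p = k)"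

definition graph_diameter :: "'a pair_pre_digraph \<Rightarrow> nat" where
  "graph_diameter G = Max {graph_dist G u v | u v. u \<in> pverts G \<and> v \<in> pverts G}"

text \<open>
  The list \<^term>\<open>vs\<close> is a labeling of the vertices: a duplicate-free enumeration of them.
\<close>

definition vertex_labeling :: "'a pair_pre_digraph \<Rightarrow> 'a list \<Rightarrow> bool" where
  "vertex_labeling G vs \<longleftrightarrow> distinct vs \<and> set vs = pverts G"

definition adjacency_mat :: "'a pair_pre_digraph \<Rightarrow> 'a list \<Rightarrow> bit mat" where
  "adjacency_mat G vs =
     mat (length vs) (length vs) (\<lambda>(i, j). if (vs ! i, vs ! j) \<in> parcs G then 1 else 0)"

text \<open>
  The block matrix \<open>[I | A]\<close>; the two lower blocks have no rows.
\<close>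

definition generator_mat :: "'a pair_pre_digraph \<Rightarrow> 'a list \<Rightarrow> bit mat" where
  "generator_mat G vs =
     (let n = length vs
      in four_block_mat (1\<^sub>m n) (adjacency_mat G vs) (0\<^sub>m 0 n) (0\<^sub>m 0 n))"

definition graph_code :: "'a pair_pre_digraph \<Rightarrow> 'a list \<Rightarrow> bit vec set" where
  "graph_code G vs = vec_space.row_space (2 * length vs) (generator_mat G vs)"

definition vec_supp :: "bit vec \<Rightarrow> nat set" where
  "vec_supp c = {i. i < dim_vec c \<and> c $ i \<noteq> 0}"

definition minimal_codeword :: "bit vec set \<Rightarrow> bit vec \<Rightarrow> bool" where
  "minimal_codeword C c \<longleftrightarrow>
     c \<in> C \<and> c \<noteq> 0\<^sub>v (dim_vec c) \<and>
     \<not> (\<exists>c'\<in>C. c' \<noteq> 0\<^sub>v (dim_vec c') \<and> vec_supp c' \<subset> vec_supp c)"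

definition num_minimal_codewords :: "'a pair_pre_digraph \<Rightarrow> 'a list \<Rightarrow> nat" where
  "num_minimal_codewords G vs = card {c. minimal_codeword (graph_code G vs) c}"

end

theory Submission
  imports Defs
begin

text \<open>
  The codewords are indexed by the vertex sets: the sum \<open>c\<^sub>S\<close> of the rows belonging to \<open>S\<close> is the
  indicator vector of \<open>S\<close>, followed by the vector that counts modulo 2, for every vertex, its
  neighbours in \<open>S\<close>. The first half shows that \<open>S \<mapsto> c\<^sub>S\<close> is injective and that
  \<open>c\<^sub>T\<close> can only have its support inside that of \<open>c\<^sub>S\<close> if \<open>T \<subseteq> S\<close>; so only nonempty proper
  subsets of \<open>S\<close> can prevent \<open>c\<^sub>S\<close> from being minimal.

  Hence \<open>c\<^sub>S\<close> is minimal for every singleton \<open>S\<close>. If \<open>u\<close> and \<open>v\<close> are distinct and not adjacent,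
  then diameter 2 provides a common neighbour \<open>w\<close>. The position of \<open>w\<close> in the second half lies in
  the supports of \<open>c\<^sub>{\<^sub>u\<^sub>}\<close> and \<open>c\<^sub>{\<^sub>v\<^sub>}\<close>, but not in that of their sum, which is therefore minimal
  as well. The singletons and the non-adjacent pairs number
  \<open>n + (n choose 2) - #E = (n + 1 choose 2) - #E\<close>.
\<close>

section \<open>Codewords as vertex sets\<close>

text \<open>
  The sum of the rows of \<open>[I | A]\<close> that belong to the vertices in \<open>S\<close>.
\<close>

definition codeword_of :: "'a pair_pre_digraph \<Rightarrow> 'a list \<Rightarrow> 'a set \<Rightarrow> bit vec" where
  "codeword_of G vs S =
     vec (2 * length vs)
       (\<lambda>k. if k < length vs then of_bool (vs ! k \<in> S)
            else (\<Sum>u\<in>S. of_bool ((u, vs ! (k - length vs)) \<in> parcs G)))"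

lemma dim_codeword_of [simp]: "dim_vec (codeword_of G vs S) = 2 * length vs"
  by (simp add: codeword_of_def)

lemma codeword_of_left:
  "k < length vs \<Longrightarrow> codeword_of G vs S $ k = of_bool (vs ! k \<in> S)"
  by (simp add: codeword_of_def)

lemma codeword_of_right:
  "k < length vs \<Longrightarrow>
     codeword_of G vs S $ (length vs + k) = (\<Sum>u\<in>S. of_bool ((u, vs ! k) \<in> parcs G))"
  by (simp add: codeword_of_def)

lemma generator_mat_carrier:
  "generator_mat G vs \<in> carrier_mat (length vs) (2 * length vs)"
  by (auto simp: generator_mat_def adjacency_mat_def Let_def)

lemma transpose_generator_mat_mult:
  assumes "distinct vs" and S: "S \<subseteq> set vs"
  shows "(generator_mat G vs)\<^sup>T *\<^sub>v vec (length vs) (\<lambda>i. of_bool (vs ! i \<in> S)) = codeword_of G vs S"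
    (is "?M\<^sup>T *\<^sub>v ?y = _")
proof (rule eq_vecI)
  let ?n = "length vs"
  note M = generator_mat_carrier[of G vs]
  show "dim_vec (?M\<^sup>T *\<^sub>v ?y) = dim_vec (codeword_of G vs S)"
    using M by simp
  fix k assume "k < dim_vec (codeword_of G vs S)"
  then have k: "k < 2 * ?n" by simp
  have *: "(?M\<^sup>T *\<^sub>v ?y) $ k = (\<Sum>i<?n. ?M $$ (i, k) * of_bool (vs ! i \<in> S))"
    using M k by (auto simp: scalar_prod_def atLeast0LessThan intro!: sum.cong)
  show "(?M\<^sup>T *\<^sub>v ?y) $ k = codeword_of G vs S $ k"
  proof (cases "k < ?n")
    case True
    have "(?M\<^sup>T *\<^sub>v ?y) $ k = (\<Sum>i<?n. if k = i then of_bool (vs ! i \<in> S) else 0)"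
      unfolding *
      using True by (intro sum.cong) (auto simp: generator_mat_def adjacency_mat_def Let_def)
    then show ?thesis using True by (simp add: codeword_of_left)
  next
    case False
    let ?f = "\<lambda>u. of_bool ((u, vs ! (k - ?n)) \<in> parcs G) :: bit"
    have "(?M\<^sup>T *\<^sub>v ?y) $ k = (\<Sum>i<?n. ?f (vs ! i) * of_bool (vs ! i \<in> S))"
      unfolding *
      using False k by (intro sum.cong) (auto simp: generator_mat_def adjacency_mat_def Let_def)
    also have "\<dots> = (\<Sum>u\<in>set vs. ?f u * of_bool (u \<in> S))"
      by (rule sum.reindex_bij_betw[OF bij_betw_nth])
         (use assms in \<open>auto simp: lessThan_def\<close>)
    also have "\<dots> = (\<Sum>u\<in>S. ?f u)"
      using S by (intro sum.mono_neutral_cong_right) auto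
    finally show ?thesis using False k by (simp add: codeword_of_def)
  qed
qed

lemma graph_code_eq:
  assumes "distinct vs"
  shows "graph_code G vs = codeword_of G vs ` Pow (set vs)"
proof -
  let ?n = "length vs"
  let ?M = "generator_mat G vs"
  let ?y = "\<lambda>S. vec ?n (\<lambda>i. of_bool (vs ! i \<in> S)) :: bit vec"
  note M = generator_mat_carrier[of G vs]
  have vectors: "carrier_vec ?n = ?y ` Pow (set vs)"
  proof (intro subset_antisym subsetI)
    fix y :: "bit vec" assume y: "y \<in> carrier_vec ?n"
    define S where "S = {vs ! i | i. i < ?n \<and> y $ i = 1}"
    have "vs ! i \<in> S \<longleftrightarrow> y $ i = 1" if "i < ?n" for i
      using that assms by (auto simp: S_def nth_eq_iff_index_eq)
    then have "y = ?y S"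
      using y by (intro eq_vecI) auto
    moreover have "S \<subseteq> set vs" by (auto simp: S_def)
    ultimately show "y \<in> ?y ` Pow (set vs)" by blast
  qed auto
  have "graph_code G vs = (\<lambda>y. ?M\<^sup>T *\<^sub>v y) ` carrier_vec ?n"
    using M by (auto simp: graph_code_def vec_space.row_space_eq[OF M])
  also have "\<dots> = codeword_of G vs ` Pow (set vs)"
    unfolding vectors image_image
    by (rule image_cong) (use assms in \<open>auto simp: transpose_generator_mat_mult\<close>)
  finally show ?thesis .
qed

lemma subset_if_vec_supp_subset:
  assumes "vec_supp (codeword_of G vs T) \<subseteq> vec_supp (codeword_of G vs S)" and "T \<subseteq> set vs"
  shows "T \<subseteq> S"
proof
  fix u assume u: "u \<in> T"
  then obtain k where k: "k < length vs" "vs ! k = u"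
    using assms(2) by (metis in_set_conv_nth subsetD)
  then have "k \<in> vec_supp (codeword_of G vs T)"
    using u by (simp add: vec_supp_def codeword_of_left)
  then have "k \<in> vec_supp (codeword_of G vs S)"
    using assms(1) by blast
  then show "u \<in> S"
    using k by (simp add: vec_supp_def codeword_of_left)
qed

lemma inj_on_codeword_of: "inj_on (codeword_of G vs) (Pow (set vs))"
  by (intro inj_onI subset_antisym; rule subset_if_vec_supp_subset[of G vs]) auto

lemma codeword_of_empty: "codeword_of G vs {} = 0\<^sub>v (2 * length vs)"
  by (rule eq_vecI) (auto simp: codeword_of_def)

lemma finite_minimal_codewords:
  "distinct vs \<Longrightarrow> finite {c. minimal_codeword (graph_code G vs) c}"
  by (rule finite_subset[of _ "graph_code G vs"]) (auto simp: graph_code_eq minimal_codeword_def)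

lemma minimal_codeword_codeword_of:
  assumes dist: "distinct vs" and S: "S \<subseteq> set vs" "S \<noteq> {}"
    and proper: "\<And>T. T \<subset> S \<Longrightarrow> T \<noteq> {} \<Longrightarrow>
      \<not> vec_supp (codeword_of G vs T) \<subseteq> vec_supp (codeword_of G vs S)"
  shows "minimal_codeword (graph_code G vs) (codeword_of G vs S)"
proof -
  have "codeword_of G vs S \<noteq> 0\<^sub>v (2 * length vs)"
    using inj_onD[OF inj_on_codeword_of, of G vs S "{}"] S
    by (auto simp: codeword_of_empty)
  moreover have False
    if T: "T \<subseteq> set vs" "codeword_of G vs T \<noteq> 0\<^sub>v (2 * length vs)"
      and supp: "vec_supp (codeword_of G vs T) \<subset> vec_supp (codeword_of G vs S)" for T
  proof -
    have "T \<subset> S"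
      using subset_if_vec_supp_subset[of G vs T S] supp T by auto
    moreover have "T \<noteq> {}"
      using T by (auto simp: codeword_of_empty)
    ultimately show False
      using proper supp by blast
  qed
  ultimately show ?thesis
    using S by (auto simp: minimal_codeword_def graph_code_eq[OF dist])
qed

section \<open>Small minimal codewords\<close>

lemma minimal_codeword_singleton:
  assumes "distinct vs" "u \<in> set vs"
  shows "minimal_codeword (graph_code G vs) (codeword_of G vs {u})"
  by (rule minimal_codeword_codeword_of) (use assms in auto)

lemma minimal_codeword_pair:
  assumes dist: "distinct vs" and uv: "u \<in> set vs" "v \<in> set vs" "u \<noteq> v"
    and w: "w \<in> set vs" "(u, w) \<in> parcs G" "(v, w) \<in> parcs G"
  shows "minimal_codeword (graph_code G vs) (codeword_of G vs {u, v})"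
proof (rule minimal_codeword_codeword_of[OF dist])
  fix T assume "T \<subset> {u, v}" "T \<noteq> {}"
  then have T: "T = {u} \<or> T = {v}" by blast
  obtain k where k: "k < length vs" "vs ! k = w"
    using w by (metis in_set_conv_nth)
  \<comment> \<open>The common neighbour \<open>w\<close> is counted once for \<open>T\<close>, but twice, hence as 0, for the pair.\<close>
  have "length vs + k \<in> vec_supp (codeword_of G vs T)"
    using T k w by (auto simp: vec_supp_def codeword_of_right)
  moreover have "length vs + k \<notin> vec_supp (codeword_of G vs {u, v})"
    using k w uv by (auto simp: vec_supp_def codeword_of_right)
  ultimately show "\<not> vec_supp (codeword_of G vs T) \<subseteq> vec_supp (codeword_of G vs {u, v})"
    by blast
qed (use uv in auto)

section \<open>Common neighbours\<close>

lemma common_neighbour_if_diameter_2: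
  assumes G: "pair_graph G" and conn: "Digraph_Component.connected (with_proj G)"
    and diam: "graph_diameter G = 2"
    and uv: "u \<in> pverts G" "v \<in> pverts G" "u \<noteq> v" "(u, v) \<notin> parcs G"
  obtains w where "w \<in> pverts G" "(u, w) \<in> parcs G" "(v, w) \<in> parcs G"
proof -
  interpret pair_graph G by fact
  have "strongly_connected (with_proj G)"
    using symmetric_connected_imp_strongly_connected[OF sym_arcs conn] .
  then have "u \<rightarrow>\<^sup>*\<^bsub>with_proj G\<^esub> v"
    using uv by (simp add: strongly_connected_def)
  \<comment> \<open>Reachability makes the least element defining the distance the length of an actual path.\<close>
  then have "\<exists>k p. apath u p v \<and> length p = k"
    using reachable_apath by auto
  then have "\<exists>p. apath u p v \<and> length p = graph_dist G u v"
    unfolding graph_dist_def by (rule LeastI_ex)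
  then obtain p where p: "apath u p v" "length p = graph_dist G u v" by blast
  let ?D = "{graph_dist G a b | a b. a \<in> pverts G \<and> b \<in> pverts G}"
  have "?D = (\<lambda>(a, b). graph_dist G a b) ` (pverts G \<times> pverts G)" by auto
  then have "finite ?D" using pair_finite_verts by simp
  then have "length p \<le> 2"
    using diam uv p(2) unfolding graph_diameter_def by (metis (mono_tags, lifting) Max_ge mem_Collect_eq)
  then consider "p = []" | e where "p = [e]" | e f where "p = [e, f]"
    by (cases p; cases "tl p"; cases "tl (tl p)") auto
  then show thesis
  proof cases
    case 3
    then have "(u, snd e) \<in> parcs G" "(snd e, v) \<in> parcs G"
      using p(1) by (cases e; cases f; auto simp: apath_Cons_iff apath_Nil_iff)+
    then show thesis
      using that in_arcsD1 arcs_symmetric by blast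
  qed (use p(1) uv in \<open>auto simp: apath_Cons_iff apath_Nil_iff\<close>)
qed

section \<open>The bound\<close>

lemma undirected_edges_subset:
  assumes "pair_graph G"
  shows "undirected_edges G \<subseteq> {S. S \<subseteq> pverts G \<and> card S = 2}"
proof -
  interpret pair_graph G by fact
  show ?thesis
    by (auto simp: undirected_edges_def card_2_iff in_arcsD1 in_arcsD2 dest: no_loops')
qed

theorem corollary2p8:
  fixes G :: "'a pair_pre_digraph" and vs :: "'a list"
  assumes "pair_graph G"
    and "Digraph_Component.connected (with_proj G)"
    and "graph_diameter G = 2"
    and "vertex_labeling G vs"
  shows "int (num_minimal_codewords G vs)
           \<ge> int ((card (pverts G) + 1) choose 2) - int (card (undirected_edges G))"
proof -
  have dist: "distinct vs" and V: "set vs = pverts G"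
    using assms(4) by (auto simp: vertex_labeling_def)
  then have fin: "finite (pverts G)" by (metis List.finite_set)
  let ?one = "{S. S \<subseteq> pverts G \<and> card S = 1}"
  let ?two = "{S. S \<subseteq> pverts G \<and> card S = 2}"
  let ?F = "?one \<union> (?two - undirected_edges G)"
  have edges: "undirected_edges G \<subseteq> ?two"
    using assms(1) by (rule undirected_edges_subset)
  have fin2: "finite ?one" "finite ?two" using fin by auto
  have "card ?F = card ?one + card (?two - undirected_edges G)"
    using fin2 by (intro card_Un_disjoint) auto
  also have "\<dots> = (card (pverts G) choose 1) + ((card (pverts G) choose 2) - card (undirected_edges G))"
    using fin fin2 edges by (simp add: n_subsets card_Diff_subset finite_subset)
  finally have card_F: "int (card ?F) \<ge>
      int ((card (pverts G) + 1) choose 2) - int (card (undirected_edges G))"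
    by (simp add: numeral_2_eq_2)
  have "codeword_of G vs ` ?F \<subseteq> {c. minimal_codeword (graph_code G vs) c}"
  proof (intro image_subsetI CollectI)
    fix S assume "S \<in> ?F"
    then consider u where "S = {u}" "u \<in> pverts G"
      | u v where "S = {u, v}" "u \<noteq> v" "u \<in> pverts G" "v \<in> pverts G" "(u, v) \<notin> parcs G"
      unfolding undirected_edges_def by (fastforce simp: card_1_singleton_iff card_2_iff)
    then show "minimal_codeword (graph_code G vs) (codeword_of G vs S)"
    proof cases
      case 1
      then show ?thesis using minimal_codeword_singleton[OF dist] V by simp
    next
      case 2
      obtain w where "w \<in> pverts G" "(u, w) \<in> parcs G" "(v, w) \<in> parcs G"
        using common_neighbour_if_diameter_2[OF assms(1-3)] 2 by metis
      then show ?thesis using minimal_codeword_pair[OF dist, of u v w] 2 V by simp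
    qed
  qed
  then have "card (codeword_of G vs ` ?F) \<le> num_minimal_codewords G vs"
    unfolding num_minimal_codewords_def
    by (rule card_mono[OF finite_minimal_codewords[OF dist]])
  moreover have "card (codeword_of G vs ` ?F) = card ?F"
    by (intro card_image inj_on_subset[OF inj_on_codeword_of]) (auto simp: V)
  ultimately show ?thesis using card_F by linarith
qed

end
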